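(* Let $\alpha\in(0,2)$ and let $f\in\mathcal{F}(\alpha)$ be such that, for some $\zeta\in\mathbb{T}$, $f'(z)=(1-z\zeta)^{-\alpha}$ for all $z\in\mathbb{D}$. Then $\|S_f\|=2\alpha(2-\alpha)$.
   Context: $\mathbb{D}=\{z\in\mathbb{C}:|z|<1\}$ and $\mathbb{T}=\{z\in\mathbb{C}:|z|=1\}$. $\mathcal{A}$ is the family of analytic functions $h$ in $\mathbb{D}$ with $h(0)=0$ and $h'(0)=1$. For $\alpha\in(0,3]$, $\mathcal{F}(\alpha)$ is the family of locally univalent functions $h\in\mathcal{A}$ (i.e. $h'(z)\neq0$ in $\mathbb{D}$) such that $\operatorname{Re}\left(1+\frac{zh''(z)}{h'(z)}\right)>1-\frac{\alpha}{2}$ for all $z\in\mathbb{D}$. For a locally univalent analytic function $f$ in $\mathbb{D}$, the Schwarzian derivative is $S_f(z)=\left(\frac{f''(z)}{f'(z)}\right)'-\frac12\left(\frac{f''(z)}{f'(z)}\right)^2$ and its norm is $\|S_f\|=\sup_{z\in\mathbb{D}}(1-|z|^2)^2|S_f(z)|$. The power $(1-z\zeta)^{-\alpha}$ is the branch equal to $1$ at $z=0$. *)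

theory Defs
  imports "HOL-Analysis.Analysis"
begin

abbreviation unit_disc :: "complex set"
  where "unit_disc \<equiv> ball 0 1"

abbreviation unit_circle :: "complex set"
  where "unit_circle \<equiv> sphere 0 1"

text \<open>
  Analytic functions on the disc are modelled as total functions; their values outside the
  disc are irrelevant, since the disc is open and \<^const>\<open>deriv\<close> is local.
\<close>

definition class_A :: "(complex \<Rightarrow> complex) set"
  where "class_A = {h. h analytic_on unit_disc \<and> h 0 = 0 \<and> deriv h 0 = 1}"

definition locally_univalent :: "(complex \<Rightarrow> complex) \<Rightarrow> bool"
  where "locally_univalent h \<longleftrightarrow> (\<forall>z\<in>unit_disc. deriv h z \<noteq> 0)"

text \<open>The family is only of interest for parameters \<open>0 < \<alpha> \<le> 3\<close>.\<close>

definition class_F :: "real \<Rightarrow> (complex \<Rightarrow> complex) set"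
  where "class_F \<alpha> =
    {h \<in> class_A. locally_univalent h \<and>
       (\<forall>z\<in>unit_disc. Re (1 + z * deriv (deriv h) z / deriv h z) > 1 - \<alpha> / 2)}"

definition schwarzian :: "(complex \<Rightarrow> complex) \<Rightarrow> complex \<Rightarrow> complex"
  where "schwarzian f z =
    deriv (\<lambda>w. deriv (deriv f) w / deriv f w) z
      - 1 / 2 * (deriv (deriv f) z / deriv f z)\<^sup>2"

text \<open>
  The supremum is taken in the extended reals, so that an unbounded Schwarzian has norm
  \<open>\<infinity>\<close>; a real value of the norm thus includes the boundedness claim.
\<close>

definition schwarzian_norm :: "(complex \<Rightarrow> complex) \<Rightarrow> ereal"
  where "schwarzian_norm f =
    (SUP z\<in>unit_disc. ereal ((1 - (cmod z)\<^sup>2)\<^sup>2 * cmod (schwarzian f z)))"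

text \<open>
  The principal power is the required branch of \<open>(1 - z\<zeta>) powr (-\<alpha>)\<close>: for
  \<open>z\<close> in the disc and \<open>\<zeta>\<close> on the circle, \<open>1 - z\<zeta>\<close> lies in the right half-plane, where
  the principal logarithm is analytic, and the value at \<open>z = 0\<close> is \<open>1\<close>.
\<close>

definition branch_power :: "real \<Rightarrow> complex \<Rightarrow> complex \<Rightarrow> complex"
  where "branch_power \<alpha> \<zeta> z = (1 - z * \<zeta>) powr (- complex_of_real \<alpha>)"

end

theory Submission
  imports Defs
begin

text \<open>
  The pre-Schwarzian of such an \<open>f\<close> is the simple pole \<open>\<alpha>\<zeta> / (1 - z\<zeta>)\<close>, so that
  \<open>S\<^sub>f(z) = (\<alpha>(2 - \<alpha>) / 2) (\<zeta> / (1 - z\<zeta>))\<^sup>2\<close> and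
  \[ (1 - |z|^2)^2 |S_f(z)| = \frac{\alpha(2-\alpha)}{2}
       \left(\frac{1 - |z|^2}{|1 - z\zeta|}\right)^2. \]
  Since \<open>|1 - z\<zeta>| \<ge> 1 - |z|\<close>, the quotient is at most \<open>1 + |z| < 2\<close>. On the radius that ends at
  the singularity \<open>\<zeta>\<^sup>-\<^sup>1\<close> of \<open>f'\<close> it equals \<open>1 + |z|\<close>, which tends to \<open>2\<close>. The supremum is
  therefore \<open>2\<alpha>(2 - \<alpha>)\<close>, approached at the boundary and not attained.
\<close>

lemma one_minus_mult_unit_circle_Re_pos:
  assumes "\<zeta> \<in> unit_circle" "z \<in> unit_disc"
  shows "Re (1 - z * \<zeta>) > 0"
proof -
  have "Re (z * \<zeta>) \<le> cmod (z * \<zeta>)"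
    by (rule complex_Re_le_cmod)
  also have "\<dots> < 1"
    using assms by (simp add: norm_mult)
  finally show ?thesis
    by simp
qed

lemma one_minus_mult_unit_circle_nonzero:
  assumes "\<zeta> \<in> unit_circle" "z \<in> unit_disc"
  shows "1 - z * \<zeta> \<noteq> 0"
proof
  assume "1 - z * \<zeta> = 0"
  then show False
    using one_minus_mult_unit_circle_Re_pos[OF assms] by (simp only: zero_complex.sel)
qed

lemma has_field_derivative_branch_power:
  assumes "\<zeta> \<in> unit_circle" "z \<in> unit_disc"
  shows "(branch_power \<alpha> \<zeta> has_field_derivative
           of_real \<alpha> * \<zeta> / (1 - z * \<zeta>) * branch_power \<alpha> \<zeta> z) (at z)"
proof -
  have "Re (1 - z * \<zeta>) > 0"
    using assms by (rule one_minus_mult_unit_circle_Re_pos)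
  then have "1 - z * \<zeta> \<notin> \<real>\<^sub>\<le>\<^sub>0"
    by (simp add: complex_nonpos_Reals_iff)
  then have "((\<lambda>w. (1 - w * \<zeta>) powr (- of_real \<alpha>)) has_field_derivative
      (- of_real \<alpha> * (1 - z * \<zeta>) powr (- of_real \<alpha> - 1)) * (- \<zeta>)) (at z)"
    by (intro DERIV_chain2[OF has_field_derivative_powr]) (auto intro!: derivative_eq_intros)
  moreover have "(1 - z * \<zeta>) powr (- of_real \<alpha> - 1)
      = (1 - z * \<zeta>) powr (- of_real \<alpha>) / (1 - z * \<zeta>)"
    using one_minus_mult_unit_circle_nonzero[OF assms] by (simp add: powr_diff)
  ultimately show ?thesis
    by (simp add: branch_power_def[abs_def] mult_ac)
qed

lemma pre_schwarzian_branch_power: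
  assumes "\<zeta> \<in> unit_circle" "z \<in> unit_disc"
    and f': "\<forall>w\<in>unit_disc. deriv f w = branch_power \<alpha> \<zeta> w"
  shows "deriv (deriv f) z / deriv f z = of_real \<alpha> * \<zeta> / (1 - z * \<zeta>)"
proof -
  have "(deriv f has_field_derivative
          of_real \<alpha> * \<zeta> / (1 - z * \<zeta>) * branch_power \<alpha> \<zeta> z) (at z)"
    by (rule has_field_derivative_transform_within_open[OF has_field_derivative_branch_power, of _ _ unit_disc])
       (use assms in auto)
  moreover have "branch_power \<alpha> \<zeta> z \<noteq> 0"
    using one_minus_mult_unit_circle_nonzero[OF assms(1,2)] by (simp add: branch_power_def)
  ultimately show ?thesis
    using f' assms(2) by (simp add: DERIV_imp_deriv)
qed

text \<open>
  For \<open>P = \<alpha>\<zeta> / (1 - z\<zeta>)\<close>, both \<open>P'\<close> and \<open>P\<^sup>2\<close> are multiples of the squared simple pole, so the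
  two terms of the Schwarzian \<open>P' - P\<^sup>2 / 2\<close> merge. They cancel at \<open>\<alpha> = 2\<close>, where \<open>f\<close> is a Moebius
  map on the disc.
\<close>

lemma schwarzian_branch_power:
  assumes "\<zeta> \<in> unit_circle" "z \<in> unit_disc"
    and f': "\<forall>w\<in>unit_disc. deriv f w = branch_power \<alpha> \<zeta> w"
  shows "schwarzian f z = of_real (\<alpha> * (2 - \<alpha>) / 2) * (\<zeta> / (1 - z * \<zeta>))\<^sup>2"
proof -
  have ne: "1 - z * \<zeta> \<noteq> 0"
    using assms(1,2) by (rule one_minus_mult_unit_circle_nonzero)
  have "((\<lambda>w. of_real \<alpha> * \<zeta> / (1 - w * \<zeta>)) has_field_derivative
      of_real \<alpha> * (\<zeta> / (1 - z * \<zeta>))\<^sup>2) (at z)"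
    using ne by (auto intro!: derivative_eq_intros simp: power2_eq_square)
  then have "((\<lambda>w. deriv (deriv f) w / deriv f w) has_field_derivative
      of_real \<alpha> * (\<zeta> / (1 - z * \<zeta>))\<^sup>2) (at z)"
    by (rule has_field_derivative_transform_within_open[of _ _ _ unit_disc])
       (use assms pre_schwarzian_branch_power[OF assms(1) _ f'] in auto)
  then have "schwarzian f z
      = of_real \<alpha> * (\<zeta> / (1 - z * \<zeta>))\<^sup>2 - 1 / 2 * (of_real \<alpha> * \<zeta> / (1 - z * \<zeta>))\<^sup>2"
    unfolding schwarzian_def
    using pre_schwarzian_branch_power[OF assms] by (simp add: DERIV_imp_deriv)
  also have "\<dots> = of_real (\<alpha> * (2 - \<alpha>) / 2) * (\<zeta> / (1 - z * \<zeta>))\<^sup>2"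
    by (simp add: power2_eq_square algebra_simps diff_divide_distrib)
  finally show ?thesis .
qed

lemma one_minus_norm_square_quotient_le_2:
  assumes "\<zeta> \<in> unit_circle" "z \<in> unit_disc"
  shows "(1 - (cmod z)\<^sup>2) / cmod (1 - z * \<zeta>) \<le> 2"
proof -
  have "1 - cmod z \<le> cmod (1 - z * \<zeta>)"
    using assms norm_triangle_ineq2[of 1 "z * \<zeta>"] by (simp add: norm_mult)
  moreover have "(1 - (cmod z)\<^sup>2) \<le> 2 * (1 - cmod z)"
    using zero_le_power2[of "1 - cmod z"] by (simp add: power2_eq_square algebra_simps)
  ultimately have "1 - (cmod z)\<^sup>2 \<le> 2 * cmod (1 - z * \<zeta>)"
    by (meson mult_left_mono order_trans zero_le_numeral)
  moreover have "cmod (1 - z * \<zeta>) > 0"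
    using one_minus_mult_unit_circle_nonzero[OF assms] by simp
  ultimately show ?thesis
    by (simp add: divide_le_eq)
qed

theorem lemma4p1:
  fixes \<alpha> :: real and f :: "complex \<Rightarrow> complex"
  assumes "0 < \<alpha>" and "\<alpha> < 2"
    and "f \<in> class_F \<alpha>"
    and "\<exists>\<zeta>\<in>unit_circle. \<forall>z\<in>unit_disc. deriv f z = branch_power \<alpha> \<zeta> z"
  shows "schwarzian_norm f = ereal (2 * \<alpha> * (2 - \<alpha>))"
proof -
  obtain \<zeta> where \<zeta>: "\<zeta> \<in> unit_circle"
    and f': "\<forall>z\<in>unit_disc. deriv f z = branch_power \<alpha> \<zeta> z"
    using assms(4) by blast
  define K where "K = \<alpha> * (2 - \<alpha>) / 2"
  have K: "K > 0"
    using assms(1,2) by (simp add: K_def)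
  define Q where "Q z = (1 - (cmod z)\<^sup>2) / cmod (1 - z * \<zeta>)" for z
  have "(1 - (cmod z)\<^sup>2)\<^sup>2 * cmod (schwarzian f z) = K * (Q z)\<^sup>2" if "z \<in> unit_disc" for z
  proof -
    have "cmod (schwarzian f z) = K * (1 / cmod (1 - z * \<zeta>))\<^sup>2"
      using \<zeta> K unfolding schwarzian_branch_power[OF \<zeta> that f'] K_def[symmetric]
      by (simp add: norm_mult norm_power norm_divide)
    then show ?thesis
      by (simp add: Q_def power_divide)
  qed
  then have norm_eq: "schwarzian_norm f = (SUP z\<in>unit_disc. ereal (K * (Q z)\<^sup>2))"
    unfolding schwarzian_norm_def by (intro SUP_cong) auto
  have "(SUP z\<in>unit_disc. ereal (K * (Q z)\<^sup>2)) \<le> ereal (K * 2\<^sup>2)"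
  proof (rule SUP_least)
    fix z assume z: "z \<in> unit_disc"
    have "Q z \<ge> 0"
      using z by (auto simp: Q_def abs_square_le_1 intro!: divide_nonneg_nonneg)
    then have "(Q z)\<^sup>2 \<le> 2\<^sup>2"
      using one_minus_norm_square_quotient_le_2[OF \<zeta> z] by (intro power_mono) (auto simp: Q_def)
    then show "ereal (K * (Q z)\<^sup>2) \<le> ereal (K * 2\<^sup>2)"
      using K by simp
  qed
  moreover have "ereal (K * 2\<^sup>2) \<le> (SUP z\<in>unit_disc. ereal (K * (Q z)\<^sup>2))" (is "_ \<le> ?S")
  proof (rule tendsto_upperbound)
    have "((\<lambda>r::real. K * (1 + r)\<^sup>2) \<longlongrightarrow> K * (1 + 1)\<^sup>2) (at_left 1)"
      by (intro tendsto_intros)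
    then show "((\<lambda>r. ereal (K * (1 + r)\<^sup>2)) \<longlongrightarrow> ereal (K * 2\<^sup>2)) (at_left 1)"
      by simp
    have "ereal (K * (1 + r)\<^sup>2) \<le> ?S" if r: "0 < r" "r < 1" for r :: real
    proof -
      \<comment> \<open>The point on the radius towards the singularity: \<open>cnj \<zeta> = 1 / \<zeta>\<close> on the circle.\<close>
      let ?z = "of_real r * cnj \<zeta>"
      have z: "?z \<in> unit_disc" "cmod ?z = r"
        using \<zeta> r by (auto simp: norm_mult)
      have "?z * \<zeta> = of_real r"
        using \<zeta> by (simp add: mult.assoc complex_norm_square[symmetric] mult.commute[of "cnj \<zeta>"])
      then have "cmod (1 - ?z * \<zeta>) = cmod (of_real (1 - r))"
        by (simp only: of_real_diff of_real_1)
      also have "\<dots> = 1 - r"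
        using r by (simp only: norm_of_real)
      finally have "Q ?z = (1 - r\<^sup>2) / (1 - r)"
        by (simp only: Q_def z(2))
      also have "\<dots> = 1 + r"
        using r by (simp add: divide_eq_eq power2_eq_square algebra_simps)
      finally have "Q ?z = 1 + r" .
      then show ?thesis
        using SUP_upper[OF z(1), of "\<lambda>z. ereal (K * (Q z)\<^sup>2)"] by simp
    qed
    then show "\<forall>\<^sub>F r in at_left 1. ereal (K * (1 + r)\<^sup>2) \<le> ?S"
      using eventually_at_left_real[of 0 "1::real"] by (auto elim!: eventually_mono)
  qed simp
  ultimately have "schwarzian_norm f = ereal (K * 2\<^sup>2)"
    unfolding norm_eq by (rule antisym)
  then show ?thesis
    by (simp add: K_def)
qed

end
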